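(* Let $Q=\{x\in\mathbb{R}^n\mid Ax\le b\}$ be a nonempty polyhedron, let $\psi:\mathbb{R}^n\to(-\infty,\infty]$ be proper and convex, let $z\in\mathrm{vert}(Q)$, $\varepsilon\ge0$, and $T=N(z)$. Assume that the vertex $z$ is nondegenerate, so that the matrix $S_T$ is invertible. Then, for any subgradient $w\in\partial(\varepsilon\psi)(z)$, $$\gamma\big(T\cap[T+\partial(\varepsilon\psi)(z)]\big)\ \ge\ \gamma(T)\exp\Big(-\tfrac12\|\tilde w\|^2-\|\tilde w\|\sqrt n\Big),\qquad \tilde w:=S_T^{-1}(S_Tw)_+ .$$ Additionally, if $\psi$ is differentiable at $z$, then $$\gamma\big(T\cap[T+\varepsilon\nabla\psi(z)]\big)\ \le\ \gamma(T)\exp\Big(-\tfrac12\|\mathrm{proj}_{T^*}\tilde w\|^2+\mathrm{dist}(\tilde w,T^* )\sqrt n\Big),$$ where now $\tilde w:=S_T^{-1}[S_T(\varepsilon\nabla\psi(z))]_+$.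
   Context: $A\in\mathbb{R}^{m\times n}$ has rows $a_i$. $\mathrm{vert}(Q)$ is the set of vertices of $Q$. A vertex $z$ is nondegenerate if exactly $n$ constraints are active at it, i.e. $|J(z)|=n$ with $J(z)=\{i\mid a_i\cdot z=b_i\}$. $N(x)=\{v\in\mathbb{R}^n\mid v\cdot(y-x)\le0\ \text{for all }y\in Q\}$ is the normal cone to $Q$ at $x$. For a vertex $z$, $T=N(z)$ is a full-dimensional polyhedral cone, written $T=\{y\in\mathbb{R}^n\mid y\cdot s^i\ge0\ \text{for all } i\in\{1,\dots,\ell\}\}$, where $s^1,\dots,s^\ell$ are the inward-facing unit normals of its facets $T^i=\{y\in T\mid s^i\cdot y=0\}$ (the $(n-1)$-dimensional faces of $T$). $S_T\in\mathbb{R}^{\ell\times n}$ is the matrix with rows $s^1,\dots,s^\ell$; at a nondegenerate vertex $\ell=n$, and $s^1,\dots,s^n$ are the normalized columns of the inverse of the matrix $A_{J(z)}$ of active rows. $x_+=\max(0,x)$ componentwise. $\gamma$ is the standard Gaussian measure on $\mathbb{R}^n$; $T^*=\{y\mid y\cdot x\ge0\ \text{for all } x\in T\}$; $\mathrm{dist}$ and $\mathrm{proj}$ are Euclidean distance and projection. Convention: for $\varepsilon>0$, $\varepsilon\psi$ is the usual scalar multiple; for $\varepsilon=0$, $\varepsilon\psi$ denotes the indicator function $\delta_{\mathrm{dom}\,\psi}$. $\partial$ is the convex subdifferential. Sums of sets are Minkowski sums. *)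

theory Defs
  imports "HOL-Analysis.Analysis"
begin

definition ineq_polyhedron :: "real^'n^'m \<Rightarrow> real^'m \<Rightarrow> (real^'n) set" where
  "ineq_polyhedron A b = {x. \<forall>i. row i A \<bullet> x \<le> b $ i}"

(* Active constraints are counted by row index, so repeated rows count separately. *)
definition active_set :: "real^'n^'m \<Rightarrow> real^'m \<Rightarrow> real^'n \<Rightarrow> 'm set" where
  "active_set A b z = {i. row i A \<bullet> z = b $ i}"

definition nondegenerate_at :: "real^'n^'m \<Rightarrow> real^'m \<Rightarrow> real^'n \<Rightarrow> bool" where
  "nondegenerate_at A b z \<longleftrightarrow> card (active_set A b z) = CARD('n)"

definition normal_cone :: "'a::real_inner set \<Rightarrow> 'a \<Rightarrow> 'a set" where
  "normal_cone Q x = {v. \<forall>y\<in>Q. v \<bullet> (y - x) \<le> 0}"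

definition dual_cone :: "'a::real_inner set \<Rightarrow> 'a set" where
  "dual_cone T = {y. \<forall>x\<in>T. 0 \<le> y \<bullet> x}"

(* Intended for full-dimensional T, where each facet has exactly one such normal. *)
definition facet_normals :: "'a::euclidean_space set \<Rightarrow> 'a set" where
  "facet_normals T =
     {s. norm s = 1 \<and> (\<forall>y\<in>T. 0 \<le> s \<bullet> y) \<and> {y \<in> T. s \<bullet> y = 0} facet_of T}"

(* The rows of S list the facet normals of T, each exactly once, in an arbitrary order. *)
definition facet_normal_matrix :: "real^'n^'l \<Rightarrow> (real^'n) set \<Rightarrow> bool" where
  "facet_normal_matrix S T \<longleftrightarrow> bij_betw (\<lambda>i. row i S) UNIV (facet_normals T)"

definition pos_part :: "real^'l \<Rightarrow> real^'l" where
  "pos_part x = (\<chi> i. max 0 (x $ i))"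

(* The vector written w with a tilde in the source; only meaningful for invertible S. *)
definition tilde :: "real^'n^'l \<Rightarrow> real^'n \<Rightarrow> real^'n" where
  "tilde S w = matrix_inv S *v pos_part (S *v w)"

definition std_gaussian :: "(real^'n) measure" where
  "std_gaussian =
     density lborel (\<lambda>x. ennreal (exp (- (norm x)\<^sup>2 / 2) / sqrt (2 * pi) ^ CARD('n)))"

definition proper_fun :: "('a \<Rightarrow> ereal) \<Rightarrow> bool" where
  "proper_fun f \<longleftrightarrow> (\<forall>x. f x \<noteq> - \<infinity>) \<and> (\<exists>x. f x \<noteq> \<infinity>)"

(* Meant for functions that never take the value minus infinity, so that the
   right-hand side never has the form infinity minus infinity. *)
definition convex_fun :: "('a::real_vector \<Rightarrow> ereal) \<Rightarrow> bool" where
  "convex_fun f \<longleftrightarrow>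
     (\<forall>x y t. 0 < t \<longrightarrow> t < 1 \<longrightarrow>
        f ((1 - t) *\<^sub>R x + t *\<^sub>R y) \<le> ereal (1 - t) * f x + ereal t * f y)"

definition eff_dom :: "('a \<Rightarrow> ereal) \<Rightarrow> 'a set" where
  "eff_dom f = {x. f x < \<infinity>}"

(* For e = 0 this is the indicator function of the domain of f; plain ereal
   multiplication would instead give the zero function. *)
definition scaled_fun :: "real \<Rightarrow> ('a \<Rightarrow> ereal) \<Rightarrow> 'a \<Rightarrow> ereal" where
  "scaled_fun e f x =
     (if e = 0 then (if x \<in> eff_dom f then 0 else \<infinity>) else ereal e * f x)"

definition subdifferential :: "('a::real_inner \<Rightarrow> ereal) \<Rightarrow> 'a \<Rightarrow> 'a set" where
  "subdifferential f x = {w. \<forall>y. f x + ereal (w \<bullet> (y - x)) \<le> f y}"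

(* Differentiability of f at x with gradient g. The function must be finite near x,
   because real_of_ereal sends infinite values to 0. *)
definition has_gradient :: "('a::real_inner \<Rightarrow> ereal) \<Rightarrow> 'a \<Rightarrow> 'a \<Rightarrow> bool" where
  "has_gradient f x g \<longleftrightarrow>
     (\<forall>\<^sub>F y in nhds x. \<bar>f y\<bar> \<noteq> \<infinity>) \<and> GDERIV (\<lambda>y. real_of_ereal (f y)) x :> g"

end

theory Submission
  imports Defs "HOL-Probability.Distributions"
begin

text \<open>
  At a nondegenerate vertex the normal cone is simplicial, so it equals \<open>{y. 0 \<le> S y}\<close> with \<open>S\<close>
  invertible, and \<open>T \<inter> (T + w) = {y. S y \<ge> (S w)\<^sub>+}\<close> is the translate of \<open>T\<close> by \<open>tilde S w\<close>.
  The Gaussian measure of \<open>T + u\<close> is the integral of \<open>exp (- u \<bullet> y - (norm u)\<^sup>2 / 2)\<close> over \<open>T\<close>, and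
  Cauchy-Schwarz (applied, for the upper bound, only to the component of \<open>u\<close> orthogonal to its
  projection on the dual cone) reduces both claims to bounding the Gaussian integral over \<open>T\<close> of
  \<open>exp (s * norm y)\<close> (with \<open>s \<le> 0\<close> for the lower bound) by that of \<open>1\<close>. Since \<open>T\<close> is invariant
  under dilation, one may substitute \<open>c *\<^sub>R y\<close> for \<open>y\<close>; for a suitable \<open>c\<close> the required inequality
  then holds pointwise.
\<close>

subsection \<open>Gaussian integrals over cones\<close>

text \<open>Comes from \<open>1 + \<delta> \<le> exp \<delta>\<close>. It lets the Jacobian of the
  dilation by \<open>sqrt (1 + \<delta>)\<close>, or of its inverse, be absorbed into an
  exponent.\<close>

lemma sqrt_power_le_exp:
  assumes "0 \<le> \<delta>"
  shows "sqrt (1 + \<delta>) ^ n \<le> exp (real n * \<delta> / 2)"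
proof -
  have "sqrt (1 + \<delta>) \<le> exp (\<delta> / 2)"
    by (rule real_le_lsqrt)
      (use assms exp_ge_add_one_self[of \<delta>] in \<open>simp_all add: power2_eq_square flip: exp_add\<close>)
  then have "sqrt (1 + \<delta>) ^ n \<le> exp (\<delta> / 2) ^ n"
    by (rule power_mono) (use assms in simp)
  then show ?thesis
    by (simp add: exp_of_nat_mult[symmetric])
qed

text \<open>Once \<open>c ^ n\<close> is replaced by \<open>exp (n * \<delta> / 2)\<close>, the gap
  between the two exponents is exactly \<open>\<delta> * (r - c * sqrt n)\<^sup>2 / 2\<close>. The
  choices of \<open>c\<close> and \<open>s\<close> are made to complete this square.\<close>

lemma dilated_gauss_exp_le:
  fixes n :: nat and \<delta> r :: real
  assumes "0 < \<delta>"
  defines "c \<equiv> sqrt (1 + \<delta>)" and "s \<equiv> \<delta> * sqrt (real n)"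
  shows "c ^ n * exp (s * (c * r) - (c * r)\<^sup>2 / 2)
         \<le> exp (s\<^sup>2 / 2 + s * sqrt (real n)) * exp (- r\<^sup>2 / 2)"
proof -
  have c2: "c\<^sup>2 = 1 + \<delta>" using assms by simp
  have q2: "(sqrt (real n))\<^sup>2 = real n" by simp
  have "0 \<le> \<delta> * (r - c * sqrt (real n))\<^sup>2 / 2"
    using assms by simp
  also have "\<dots> = \<delta> * r\<^sup>2 / 2 + (\<delta> * c\<^sup>2 * (sqrt (real n))\<^sup>2) / 2 - s * (c * r)"
    by (simp add: s_def power2_eq_square algebra_simps add_divide_distrib diff_divide_distrib)
  finally have "real n * \<delta> / 2 + (s * (c * r) - c\<^sup>2 * r\<^sup>2 / 2)
      \<le> s\<^sup>2 / 2 + s * sqrt (real n) - r\<^sup>2 / 2"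
    unfolding c2 s_def
    by (simp add: power_mult_distrib power2_eq_square algebra_simps add_divide_distrib)
  then have "exp (real n * \<delta> / 2) * exp (s * (c * r) - (c * r)\<^sup>2 / 2)
      \<le> exp (s\<^sup>2 / 2 + s * sqrt (real n)) * exp (- r\<^sup>2 / 2)"
    by (simp add: power_mult_distrib flip: exp_add)
  moreover have "c ^ n \<le> exp (real n * \<delta> / 2)"
    unfolding c_def using sqrt_power_le_exp assms by simp
  ultimately show ?thesis
    by (meson exp_ge_zero mult_right_mono order_trans)
qed

text \<open>The counterpart for a contraction: with \<open>c ^ n\<close> replaced by its lower bound
  \<open>exp (- n * \<delta> / 2)\<close>, the gap between the exponents is
  \<open>\<delta> * (c * r - sqrt n)\<^sup>2 / 2\<close>. The constant term of this square is
  \<open>\<delta> * n / 2\<close>, so no term in \<open>s\<^sup>2\<close> is lost.\<close>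

lemma dilated_gauss_exp_ge:
  fixes n :: nat and \<delta> r :: real
  assumes "0 < \<delta>"
  defines "c \<equiv> inverse (sqrt (1 + \<delta>))" and "s \<equiv> \<delta> * sqrt (real n)"
  shows "exp (- s * sqrt (real n)) * exp (- r\<^sup>2 / 2)
         \<le> c ^ n * exp (- s * (c * r) - (c * r)\<^sup>2 / 2)"
proof -
  have "c\<^sup>2 = inverse (1 + \<delta>)" using assms by (simp add: power_inverse)
  then have c2: "c\<^sup>2 * (1 + \<delta>) = 1" using assms by (simp add: field_simps)
  have r2: "r\<^sup>2 = (c * r)\<^sup>2 * (1 + \<delta>)"
    using c2 by (simp add: power_mult_distrib mult.assoc mult.left_commute)
  have "0 \<le> \<delta> * (c * r - sqrt (real n))\<^sup>2 / 2"
    using assms by simp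
  also have "\<dots> = \<delta> * (c * r)\<^sup>2 / 2 + \<delta> * (sqrt (real n))\<^sup>2 / 2 - s * (c * r)"
    by (simp add: s_def power2_eq_square algebra_simps add_divide_distrib diff_divide_distrib)
  finally have "- s * sqrt (real n) - r\<^sup>2 / 2
      \<le> - (real n * \<delta> / 2) + (- s * (c * r) - (c * r)\<^sup>2 / 2)"
    unfolding r2 s_def
    by (simp add: power2_eq_square algebra_simps add_divide_distrib)
  then have "exp (- s * sqrt (real n)) * exp (- r\<^sup>2 / 2)
      \<le> exp (- (real n * \<delta> / 2)) * exp (- s * (c * r) - (c * r)\<^sup>2 / 2)"
    by (simp flip: exp_add)
  moreover have "exp (- (real n * \<delta> / 2)) \<le> c ^ n"
    unfolding c_def exp_minus power_inverse
    using sqrt_power_le_exp[of \<delta> n] assms by (intro le_imp_inverse_le) simp_all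
  ultimately show ?thesis
    by (meson exp_ge_zero mult_right_mono order_trans)
qed

section \<open>Changes of variables and exponential moments over a cone\<close>

lemma nn_integral_lborel_translate:
  fixes f :: "'a::euclidean_space \<Rightarrow> ennreal"
  assumes "f \<in> borel_measurable borel"
  shows "(\<integral>\<^sup>+x. f x \<partial>lborel) = (\<integral>\<^sup>+x. f (x + u) \<partial>lborel)"
proof -
  have "(\<integral>\<^sup>+x. f x \<partial>lborel) = (\<integral>\<^sup>+x. f x \<partial>distr lborel borel ((+) u))"
    by (simp add: lborel_distr_plus)
  also have "\<dots> = (\<integral>\<^sup>+x. f (u + x) \<partial>lborel)"
    by (rule nn_integral_distr) (use assms in simp_all)
  finally show ?thesis by (simp add: add.commute)
qed

text \<open>A positive dilation maps the cone onto itself, so the domain of integration stays the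
  same and only the Jacobian and the rescaled argument appear.\<close>

lemma nn_integral_cone_dilate:
  fixes f :: "'a::euclidean_space \<Rightarrow> ennreal"
  assumes f: "f \<in> borel_measurable borel" and T: "T \<in> sets borel"
    and cone: "cone T" and c: "0 < c"
  shows "(\<integral>\<^sup>+x\<in>T. f x \<partial>lborel) = (\<integral>\<^sup>+x\<in>T. ennreal (c ^ DIM('a)) * f (c *\<^sub>R x) \<partial>lborel)"
proof -
  have ind: "indicator T (c *\<^sub>R x) = (indicator T x :: ennreal)" for x
  proof -
    have "x \<in> T" if "c *\<^sub>R x \<in> T"
      using mem_cone[OF cone that, of "inverse c"] c by simp
    then show ?thesis
      using mem_cone[OF cone, of x c] c by (auto simp: indicator_def)
  qed
  have meas: "(\<lambda>x. f x * indicator T x) \<in> borel_measurable borel"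
    using f T by measurable
  have "(\<integral>\<^sup>+x\<in>T. f x \<partial>lborel)
      = (\<integral>\<^sup>+x. f x * indicator T x
           \<partial>density (distr lborel borel (\<lambda>x. 0 + c *\<^sub>R x)) (\<lambda>_. \<bar>c\<bar> ^ DIM('a)))"
    using c by (subst lborel_affine[of c 0]) simp_all
  also have "\<dots> = (\<integral>\<^sup>+x. ennreal (c ^ DIM('a)) * (f x * indicator T x)
                    \<partial>distr lborel borel (\<lambda>x. 0 + c *\<^sub>R x))"
    using c meas by (subst nn_integral_density) simp_all
  also have "\<dots> = (\<integral>\<^sup>+x. ennreal (c ^ DIM('a)) * (f (c *\<^sub>R x) * indicator T (c *\<^sub>R x)) \<partial>lborel)"
    using meas by (subst nn_integral_distr) simp_all
  finally show ?thesis
    by (simp add: ind mult.assoc)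
qed

text \<open>After the dilation of the left integral, \<open>dilated_gauss_exp_le\<close> compares
  the integrands pointwise, whatever the shape of the cone.\<close>

lemma gauss_exp_cone_le:
  fixes T :: "'a::euclidean_space set"
  assumes T: "T \<in> sets borel" and cone: "cone T" and s: "0 \<le> s"
  defines "d \<equiv> sqrt (real DIM('a))"
  shows "(\<integral>\<^sup>+x\<in>T. ennreal (exp (s * norm x - (norm x)\<^sup>2 / 2)) \<partial>lborel)
         \<le> ennreal (exp (s\<^sup>2 / 2 + s * d)) * (\<integral>\<^sup>+x\<in>T. ennreal (exp (- (norm x)\<^sup>2 / 2)) \<partial>lborel)"
proof (cases "s = 0")
  case False
  \<comment> \<open>Gives \<open>s = \<delta> * d\<close>, the form that the pointwise bound
    requires. That bound also needs \<open>0 < \<delta>\<close>, hence the separate case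
    \<open>s = 0\<close>, where both sides agree.\<close>
  define \<delta> where "\<delta> = s / d"
  have d: "0 < d" by (simp add: d_def)
  have \<delta>: "0 < \<delta>" and s_eq: "s = \<delta> * d"
    using False s d by (simp_all add: \<delta>_def)
  define c where "c = sqrt (1 + \<delta>)"
  have c: "0 < c" using \<delta> by (simp add: c_def)
  have "(\<integral>\<^sup>+x\<in>T. ennreal (exp (s * norm x - (norm x)\<^sup>2 / 2)) \<partial>lborel)
      = (\<integral>\<^sup>+x\<in>T. ennreal (c ^ DIM('a))
           * ennreal (exp (s * norm (c *\<^sub>R x) - (norm (c *\<^sub>R x))\<^sup>2 / 2)) \<partial>lborel)"
    by (rule nn_integral_cone_dilate[OF _ T cone c]) measurable
  also have "\<dots> \<le> (\<integral>\<^sup>+x. ennreal (exp (s\<^sup>2 / 2 + s * d))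
                   * (ennreal (exp (- (norm x)\<^sup>2 / 2)) * indicator T x) \<partial>lborel)"
    unfolding mult.assoc[symmetric]
    by (intro nn_integral_mono mult_right_mono)
      (use dilated_gauss_exp_le[OF \<delta>, of "DIM('a)"] c in
        \<open>simp_all add: s_eq d_def c_def ennreal_leI flip: ennreal_mult'\<close>)
  also have "\<dots> = ennreal (exp (s\<^sup>2 / 2 + s * d))
                  * (\<integral>\<^sup>+x\<in>T. ennreal (exp (- (norm x)\<^sup>2 / 2)) \<partial>lborel)"
    by (rule nn_integral_cmult) (use T in measurable)
  finally show ?thesis .
qed simp

text \<open>The scheme of \<open>gauss_exp_cone_le\<close> with a damping factor: the substitution
  is now a contraction and the pointwise bound is from below.\<close>

lemma gauss_exp_cone_ge:
  fixes T :: "'a::euclidean_space set"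
  assumes T: "T \<in> sets borel" and cone: "cone T" and s: "0 \<le> s"
  defines "d \<equiv> sqrt (real DIM('a))"
  shows "ennreal (exp (- s * d)) * (\<integral>\<^sup>+x\<in>T. ennreal (exp (- (norm x)\<^sup>2 / 2)) \<partial>lborel)
         \<le> (\<integral>\<^sup>+x\<in>T. ennreal (exp (- s * norm x - (norm x)\<^sup>2 / 2)) \<partial>lborel)"
proof (cases "s = 0")
  case False
  define \<delta> where "\<delta> = s / d"
  have d: "0 < d" by (simp add: d_def)
  have \<delta>: "0 < \<delta>" and s_eq: "s = \<delta> * d"
    using False s d by (simp_all add: \<delta>_def)
  define c where "c = inverse (sqrt (1 + \<delta>))"
  have c: "0 < c" using \<delta> by (simp add: c_def)
  have "ennreal (exp (- s * d)) * (\<integral>\<^sup>+x\<in>T. ennreal (exp (- (norm x)\<^sup>2 / 2)) \<partial>lborel)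
      = (\<integral>\<^sup>+x. ennreal (exp (- s * d))
           * (ennreal (exp (- (norm x)\<^sup>2 / 2)) * indicator T x) \<partial>lborel)"
    by (rule nn_integral_cmult[symmetric]) (use T in measurable)
  also have "\<dots> \<le> (\<integral>\<^sup>+x\<in>T. ennreal (c ^ DIM('a))
           * ennreal (exp (- s * norm (c *\<^sub>R x) - (norm (c *\<^sub>R x))\<^sup>2 / 2)) \<partial>lborel)"
    unfolding mult.assoc[symmetric]
    by (intro nn_integral_mono mult_right_mono)
      (use dilated_gauss_exp_ge[OF \<delta>, of "DIM('a)"] c in
        \<open>simp_all add: s_eq d_def c_def ennreal_leI flip: ennreal_mult'\<close>)
  also have "\<dots> = (\<integral>\<^sup>+x\<in>T. ennreal (exp (- s * norm x - (norm x)\<^sup>2 / 2)) \<partial>lborel)"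
    by (rule nn_integral_cone_dilate[OF _ T cone c, symmetric]) measurable
  finally show ?thesis .
qed simp

text \<open>The integrand over the whole space factors along the orthonormal basis, which reduces
  the claim to integrability of the one-dimensional normal density.\<close>

lemma nn_integral_gauss_finite:
  fixes T :: "'a::euclidean_space set"
  shows "(\<integral>\<^sup>+x\<in>T. ennreal (exp (- (norm x)\<^sup>2 / 2)) \<partial>lborel) < \<infinity>"
proof -
  have one: "(\<integral>\<^sup>+t. ennreal (exp (- t\<^sup>2 / 2)) \<partial>lborel) < \<infinity>"
  proof -
    have "integrable lborel (\<lambda>t. sqrt (2 * pi) * std_normal_density t)"
      using integrable_std_normal_moment[of 0] by simp
    then have "integrable lborel (\<lambda>t::real. exp (- t\<^sup>2 / 2))"
      by (simp add: std_normal_density_def)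
    then show ?thesis by (simp add: integrable_iff_bounded)
  qed
  have "(\<integral>\<^sup>+x\<in>T. ennreal (exp (- (norm x)\<^sup>2 / 2)) \<partial>lborel)
      \<le> (\<integral>\<^sup>+x. ennreal (exp (- (norm (x::'a))\<^sup>2 / 2)) \<partial>lborel)"
    by (rule nn_integral_mono) (simp split: split_indicator)
  also have "\<dots> = (\<integral>\<^sup>+x. (\<Prod>b\<in>(Basis::'a set). ennreal (exp (- (x \<bullet> b)\<^sup>2 / 2))) \<partial>lborel)"
  proof (rule nn_integral_cong)
    fix x :: 'a
    have "(norm x)\<^sup>2 = (\<Sum>b\<in>Basis. (x \<bullet> b)\<^sup>2)"
      by (simp add: norm_eq_sqrt_inner euclidean_inner[of x x] sum_nonneg power2_eq_square)
    then show "ennreal (exp (- (norm x)\<^sup>2 / 2)) = (\<Prod>b\<in>Basis. ennreal (exp (- (x \<bullet> b)\<^sup>2 / 2)))"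
      by (simp add: prod_ennreal sum_divide_distrib flip: exp_sum sum_negf)
  qed
  also have "\<dots> = (\<Prod>b\<in>(Basis::'a set). \<integral>\<^sup>+t. ennreal (exp (- t\<^sup>2 / 2)) \<partial>lborel)"
    by (rule nn_integral_lborel_prod) simp_all
  also have "\<dots> < \<infinity>"
    using one by (simp add: power_less_top_ennreal)
  finally show ?thesis .
qed

section \<open>Gaussian measure of a cone and of its translates\<close>

lemma emeasure_std_gaussian:
  assumes "X \<in> sets borel"
  shows "emeasure (std_gaussian :: (real^'n) measure) X
         = ennreal (inverse (sqrt (2 * pi) ^ CARD('n)))
           * (\<integral>\<^sup>+x\<in>X. ennreal (exp (- (norm x)\<^sup>2 / 2)) \<partial>lborel)"
proof -
  have dens: "ennreal (a / K) = ennreal (inverse K) * ennreal a" if "0 \<le> a" "0 \<le> K" for a K :: real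
    using that by (simp add: divide_inverse mult.commute flip: ennreal_mult)
  have "emeasure (std_gaussian :: (real^'n) measure) X
      = (\<integral>\<^sup>+x. ennreal (inverse (sqrt (2 * pi) ^ CARD('n)))
           * (ennreal (exp (- (norm x)\<^sup>2 / 2)) * indicator X x) \<partial>lborel)"
    unfolding std_gaussian_def using assms
    by (subst emeasure_density) (simp_all add: dens mult.assoc)
  then show ?thesis
    using assms by (simp add: nn_integral_cmult)
qed

text \<open>Finiteness lets inequalities between extended measures pass to \<open>measure\<close>,
  since \<open>enn2real\<close> sends infinity to 0.\<close>

lemma emeasure_std_gaussian_finite:
  "emeasure (std_gaussian :: (real^'n) measure) X < \<infinity>"
proof (cases "X \<in> sets borel")
  case True
  then show ?thesis
    using nn_integral_gauss_finite[of X] by (simp add: emeasure_std_gaussian ennreal_mult_less_top)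
next
  \<comment> \<open>Outside the sigma-algebra \<open>emeasure\<close> takes the default value
    0.\<close>
  case False
  then show ?thesis by (simp add: emeasure_notin_sets std_gaussian_def)
qed

lemma emeasure_std_gaussian_translate:
  fixes X :: "(real^'n) set"
  assumes X: "X \<in> sets borel"
  shows "emeasure std_gaussian ((\<lambda>x. x + u) ` X)
         = ennreal (inverse (sqrt (2 * pi) ^ CARD('n)))
           * (\<integral>\<^sup>+x\<in>X. ennreal (exp (- (norm (x + u))\<^sup>2 / 2)) \<partial>lborel)"
proof -
  \<comment> \<open>As a preimage under a continuous map, the translate is visibly Borel.\<close>
  have img: "(\<lambda>x. x + u) ` X = (\<lambda>x. x - u) -` X"
    by (auto simp: image_iff) (metis diff_add_cancel)
  have Y: "(\<lambda>x. x + u) ` X \<in> sets borel"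
    unfolding img using measurable_sets[of "\<lambda>x. x - u" borel borel X] X by simp
  have "(\<integral>\<^sup>+x\<in>(\<lambda>x. x + u) ` X. ennreal (exp (- (norm x)\<^sup>2 / 2)) \<partial>lborel)
     = (\<integral>\<^sup>+x. ennreal (exp (- (norm (x + u))\<^sup>2 / 2))
          * indicator ((\<lambda>x. x + u) ` X) (x + u) \<partial>lborel)"
    by (rule nn_integral_lborel_translate) (use Y in measurable)
  moreover have "indicator ((\<lambda>x. x + u) ` X) (x + u) = (indicator X x :: ennreal)" for x
    by (simp add: indicator_def image_iff)
  ultimately show ?thesis
    by (simp only: emeasure_std_gaussian[OF Y])
qed

text \<open>By the triangle inequality the shifted density is at least
  \<open>exp (- (norm u)\<^sup>2 / 2)\<close> times the damped Gaussian of
  \<open>gauss_exp_cone_ge\<close> with \<open>s = norm u\<close>.\<close>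

lemma gaussian_cone_translate_ge:
  fixes T :: "(real^'n) set"
  assumes T: "T \<in> sets borel" and cone: "cone T"
  shows "measure std_gaussian T * exp (- (1/2) * (norm u)\<^sup>2 - norm u * sqrt (real CARD('n)))
         \<le> measure std_gaussian ((\<lambda>x. x + u) ` T)"
proof -
  let ?E = "exp (- (1/2) * (norm u)\<^sup>2 - norm u * sqrt (real CARD('n)))"
  let ?K = "ennreal (inverse (sqrt (2 * pi) ^ CARD('n)))"
  have "ennreal ?E * (\<integral>\<^sup>+x\<in>T. ennreal (exp (- (norm x)\<^sup>2 / 2)) \<partial>lborel)
      = ennreal (exp (- (norm u)\<^sup>2 / 2))
        * (ennreal (exp (- norm u * sqrt (real CARD('n))))
           * (\<integral>\<^sup>+x\<in>T. ennreal (exp (- (norm x)\<^sup>2 / 2)) \<partial>lborel))"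
    by (simp add: mult.assoc[symmetric] flip: ennreal_mult' exp_add)
  also have "\<dots> \<le> ennreal (exp (- (norm u)\<^sup>2 / 2))
      * (\<integral>\<^sup>+x\<in>T. ennreal (exp (- norm u * norm x - (norm x)\<^sup>2 / 2)) \<partial>lborel)"
    using gauss_exp_cone_ge[OF T cone, of "norm u"] by (intro mult_left_mono) simp_all
  also have "\<dots> = (\<integral>\<^sup>+x. ennreal (exp (- (norm u)\<^sup>2 / 2))
      * (ennreal (exp (- norm u * norm x - (norm x)\<^sup>2 / 2)) * indicator T x) \<partial>lborel)"
    by (rule nn_integral_cmult[symmetric]) (use T in measurable)
  also have "\<dots> \<le> (\<integral>\<^sup>+x\<in>T. ennreal (exp (- (norm (x + u))\<^sup>2 / 2)) \<partial>lborel)"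
  proof (rule nn_integral_mono)
    fix x :: "real^'n"
    have "(norm (x + u))\<^sup>2 \<le> (norm x + norm u)\<^sup>2"
      by (intro power_mono norm_triangle_ineq) simp
    then have "exp (- (norm u)\<^sup>2 / 2) * exp (- norm u * norm x - (norm x)\<^sup>2 / 2)
        \<le> exp (- (norm (x + u))\<^sup>2 / 2)"
      by (simp add: power2_sum field_simps flip: exp_add)
    then show "ennreal (exp (- (norm u)\<^sup>2 / 2))
        * (ennreal (exp (- norm u * norm x - (norm x)\<^sup>2 / 2)) * indicator T x)
      \<le> ennreal (exp (- (norm (x + u))\<^sup>2 / 2)) * indicator T x"
      by (simp add: ennreal_leI split: split_indicator flip: ennreal_mult')
  qed
  finally have "ennreal ?E * emeasure std_gaussian T \<le> emeasure std_gaussian ((\<lambda>x. x + u) ` T)"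
    unfolding emeasure_std_gaussian[OF T] emeasure_std_gaussian_translate[OF T] mult.left_commute[of _ ?K]
    by (rule mult_left_mono) simp
  then have "enn2real (ennreal ?E * emeasure std_gaussian T) \<le> measure std_gaussian ((\<lambda>x. x + u) ` T)"
    unfolding measure_def using emeasure_std_gaussian_finite by (intro enn2real_mono) simp_all
  then show ?thesis
    by (simp add: enn2real_mult measure_def mult.commute)
qed

text \<open>On \<open>T\<close> the component \<open>p\<close> contributes a nonnegative amount to
  \<open>x \<bullet> u\<close>, so Cauchy-Schwarz is spent on \<open>q\<close> alone and
  \<open>gauss_exp_cone_le\<close> applies with \<open>s = norm q\<close>.\<close>

lemma gaussian_cone_translate_le:
  fixes T :: "(real^'n) set"
  assumes T: "T \<in> sets borel" and cone: "cone T"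
    and p: "p \<in> dual_cone T" and u: "u = p + q" and pq: "p \<bullet> q = 0"
  shows "measure std_gaussian ((\<lambda>x. x + u) ` T)
         \<le> measure std_gaussian T * exp (- (1/2) * (norm p)\<^sup>2 + norm q * sqrt (real CARD('n)))"
proof -
  let ?E = "exp (- (1/2) * (norm p)\<^sup>2 + norm q * sqrt (real CARD('n)))"
  let ?K = "ennreal (inverse (sqrt (2 * pi) ^ CARD('n)))"
  have u2: "(norm u)\<^sup>2 = (norm p)\<^sup>2 + (norm q)\<^sup>2"
    using pq by (simp add: u norm_add_Pythagorean orthogonal_def)
  \<comment> \<open>By Pythagoras, the \<open>(norm q)\<^sup>2 / 2\<close> produced by the
    exponential moment cancels against the part of \<open>(norm u)\<^sup>2 / 2\<close> that belongs
    to \<open>q\<close>.\<close>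
  then have expo: "- (norm u)\<^sup>2 / 2 + ((norm q)\<^sup>2 / 2 + norm q * sqrt (real CARD('n)))
      = - (1/2) * (norm p)\<^sup>2 + norm q * sqrt (real CARD('n))"
    by (simp add: field_simps)
  have "(\<integral>\<^sup>+x\<in>T. ennreal (exp (- (norm (x + u))\<^sup>2 / 2)) \<partial>lborel)
    \<le> (\<integral>\<^sup>+x. ennreal (exp (- (norm u)\<^sup>2 / 2))
      * (ennreal (exp (norm q * norm x - (norm x)\<^sup>2 / 2)) * indicator T x) \<partial>lborel)"
  proof (rule nn_integral_mono)
    fix x :: "real^'n"
    have "- (norm q * norm x) \<le> x \<bullet> u" if "x \<in> T"
    proof -
      have "0 \<le> x \<bullet> p" using p that by (simp add: dual_cone_def inner_commute[of x p])
      moreover have "- (norm q * norm x) \<le> x \<bullet> q"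
        using Cauchy_Schwarz_ineq2[of x q] by (simp add: mult.commute)
      ultimately show ?thesis by (simp add: u inner_add_right)
    qed
    then have "exp (- (norm (x + u))\<^sup>2 / 2)
        \<le> exp (- (norm u)\<^sup>2 / 2) * exp (norm q * norm x - (norm x)\<^sup>2 / 2)" if "x \<in> T"
      using that by (simp add: power2_norm_eq_inner inner_add inner_commute field_simps flip: exp_add)
    then show "ennreal (exp (- (norm (x + u))\<^sup>2 / 2)) * indicator T x
      \<le> ennreal (exp (- (norm u)\<^sup>2 / 2))
        * (ennreal (exp (norm q * norm x - (norm x)\<^sup>2 / 2)) * indicator T x)"
      by (simp add: ennreal_leI split: split_indicator flip: ennreal_mult')
  qed
  also have "\<dots> = ennreal (exp (- (norm u)\<^sup>2 / 2))
      * (\<integral>\<^sup>+x\<in>T. ennreal (exp (norm q * norm x - (norm x)\<^sup>2 / 2)) \<partial>lborel)"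
    by (rule nn_integral_cmult) (use T in measurable)
  also have "\<dots> \<le> ennreal (exp (- (norm u)\<^sup>2 / 2))
        * (ennreal (exp ((norm q)\<^sup>2 / 2 + norm q * sqrt (real CARD('n))))
           * (\<integral>\<^sup>+x\<in>T. ennreal (exp (- (norm x)\<^sup>2 / 2)) \<partial>lborel))"
    using gauss_exp_cone_le[OF T cone, of "norm q"] by (intro mult_left_mono) simp_all
  also have "\<dots> = ennreal ?E * (\<integral>\<^sup>+x\<in>T. ennreal (exp (- (norm x)\<^sup>2 / 2)) \<partial>lborel)"
    unfolding mult.assoc[symmetric] ennreal_mult'[OF exp_ge_zero, symmetric] exp_add[symmetric] expo ..
  finally have "emeasure std_gaussian ((\<lambda>x. x + u) ` T) \<le> ennreal ?E * emeasure std_gaussian T"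
    unfolding emeasure_std_gaussian[OF T] emeasure_std_gaussian_translate[OF T] mult.left_commute[of _ ?K]
    by (rule mult_left_mono) simp
  then have "measure std_gaussian ((\<lambda>x. x + u) ` T) \<le> enn2real (ennreal ?E * emeasure std_gaussian T)"
    unfolding measure_def using emeasure_std_gaussian_finite[of T]
    by (intro enn2real_mono) (simp_all add: ennreal_mult_less_top)
  then show ?thesis
    by (simp add: enn2real_mult measure_def mult.commute)
qed

subsection \<open>Simplicial cones\<close>

text \<open>The sum of two closed sets need not be closed, but it is \<open>\<sigma>\<close>-compact.\<close>

lemma set_plus_closed_borel:
  fixes S T :: "'a::euclidean_space set"
  assumes "closed S" "closed T"
  shows "S + T \<in> sets borel"
proof -
  have "S + T = (\<Union>n. (S \<inter> cball 0 (real n)) + (T \<inter> cball 0 (real n)))"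
  proof (intro equalityI subsetI)
    fix x assume "x \<in> S + T"
    then obtain s t where st: "s \<in> S" "t \<in> T" "x = s + t"
      by (auto simp: set_plus_def)
    obtain n where "max (norm s) (norm t) \<le> real n"
      using real_arch_simple by blast
    then have "s \<in> S \<inter> cball 0 (real n)" "t \<in> T \<inter> cball 0 (real n)"
      using st by simp_all
    then show "x \<in> (\<Union>n. (S \<inter> cball 0 (real n)) + (T \<inter> cball 0 (real n)))"
      unfolding st(3) by (blast intro: set_plus_intro)
  qed (auto simp: set_plus_def)
  moreover have "closed ((S \<inter> cball 0 (real n)) + (T \<inter> cball 0 (real n)))" for n
  proof -
    have "compact {x + y | x y. x \<in> S \<inter> cball 0 (real n) \<and> y \<in> T \<inter> cball 0 (real n)}"
      using assms by (intro compact_sums closed_Int_compact compact_cball)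
    moreover have "{x + y | x y. x \<in> S \<inter> cball 0 (real n) \<and> y \<in> T \<inter> cball 0 (real n)}
      = (S \<inter> cball 0 (real n)) + (T \<inter> cball 0 (real n))"
      unfolding set_plus_def by blast
    ultimately show ?thesis by (simp add: compact_imp_closed)
  qed
  ultimately show ?thesis by (simp add: borel_closed)
qed

text \<open>Each \<open>y\<close> restricts \<open>w\<close> to a closed half-space, to the whole
  space or to the empty set, depending on which values are infinite. Closedness makes the sum of
  \<open>T\<close> and the subdifferential Borel.\<close>

lemma closed_subdifferential:
  fixes f :: "'a::real_inner \<Rightarrow> ereal"
  shows "closed (subdifferential f x)"
proof -
  have "closed {w. f x + ereal (w \<bullet> (y - x)) \<le> f y}" for y
  proof (cases "f x")
    case (real r)
    have "closed {w. ereal (r + w \<bullet> (y - x)) \<le> f y}"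
    proof (cases "f y")
      case (real r')
      have "closed {w. r + w \<bullet> (y - x) \<le> r'}"
        by (intro closed_Collect_le continuous_intros)
      then show ?thesis by (simp add: real)
    qed simp_all
    then show ?thesis by (simp add: real)
  qed simp_all
  moreover have "subdifferential f x = (\<Inter>y. {w. f x + ereal (w \<bullet> (y - x)) \<le> f y})"
    by (auto simp: subdifferential_def)
  ultimately show ?thesis by (simp add: closed_INT)
qed

section \<open>Cones cut out by an invertible matrix\<close>

lemma matrix_vector_nth: "(A *v x) $ i = row i A \<bullet> (x :: real^'n)"
  by (simp add: matrix_vector_mult_def row_def inner_vec_def)

text \<open>The two index types may differ, because the rows of a facet normal matrix carry their
  own index type.\<close>

lemma matrix_inv_mult:
  fixes S :: "real^'n^'l"
  assumes "invertible S"
  shows "S ** matrix_inv S = mat 1" and "matrix_inv S ** S = mat 1"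
proof -
  have "S ** matrix_inv S = mat 1 \<and> matrix_inv S ** S = mat 1"
    unfolding matrix_inv_def by (rule someI_ex) (use assms in \<open>simp add: invertible_def\<close>)
  then show "S ** matrix_inv S = mat 1" "matrix_inv S ** S = mat 1" by blast+
qed

lemma
  fixes S :: "real^'n^'l"
  assumes "invertible S"
  shows mult_matrix_inv_vec: "S *v (matrix_inv S *v x) = x"
    and matrix_inv_mult_vec: "matrix_inv S *v (S *v y) = y"
  using matrix_inv_mult[OF assms] by (simp_all add: matrix_vector_mul_assoc)

text \<open>The preimage of the nonnegative orthant; for invertible \<open>S\<close> this is a
  simplicial cone. The free row index type covers both a facet normal matrix and a square
  matrix.\<close>

definition matrix_cone :: "real^'n^'l \<Rightarrow> (real^'n) set" where
  "matrix_cone S = {v. \<forall>l. 0 \<le> (S *v v) $ l}"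

lemma matrix_cone_eq_INT: "matrix_cone S = (\<Inter>l. {v. 0 \<le> row l S \<bullet> v})"
  by (auto simp: matrix_cone_def matrix_vector_nth)

lemma closed_matrix_cone: "closed (matrix_cone S)"
  unfolding matrix_cone_eq_INT
  by (intro closed_INT ballI closed_Collect_le continuous_intros)

lemma cone_matrix_cone: "cone (matrix_cone S)"
  by (auto simp: cone_def matrix_cone_def matrix_vector_mult_scaleR)

lemma convex_matrix_cone: "convex (matrix_cone S)"
  by (auto simp: convex_def matrix_cone_def matrix_vector_mult_scaleR matrix_vector_right_distrib)

text \<open>In the coordinates \<open>S *v x\<close> the two cones are orthants with apexes 0 and
  \<open>S *v w\<close>. They meet in the orthant whose apex is the componentwise maximum, and
  \<open>tilde S w\<close> is the point with these coordinates.\<close>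

lemma matrix_cone_Int_translate:
  fixes S :: "real^'n^'l"
  assumes "invertible S"
  shows "matrix_cone S \<inter> (matrix_cone S + {w}) = (\<lambda>x. x + tilde S w) ` matrix_cone S"
proof -
  have St: "S *v tilde S w = pos_part (S *v w)"
    by (simp add: tilde_def mult_matrix_inv_vec[OF assms])
  have add: "x \<in> matrix_cone S + {u} \<longleftrightarrow> (\<forall>l. (S *v u) $ l \<le> (S *v x) $ l)" for x u
  proof -
    have "x \<in> matrix_cone S + {u} \<longleftrightarrow> x - u \<in> matrix_cone S"
      unfolding set_plus_def by (auto intro: bexI[of _ "x - u"])
    then show ?thesis by (simp add: matrix_cone_def matrix_vector_mult_diff_distrib)
  qed
  have "(\<lambda>x. x + tilde S w) ` matrix_cone S = matrix_cone S + {tilde S w}"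
    by (auto simp: set_plus_def)
  moreover have "x \<in> matrix_cone S \<inter> (matrix_cone S + {w}) \<longleftrightarrow> x \<in> matrix_cone S + {tilde S w}" for x
    by (auto simp: add St pos_part_def) (simp_all add: matrix_cone_def)
  ultimately show ?thesis by blast
qed

text \<open>Splitting \<open>P *v v\<close> into positive and negative parts writes \<open>v\<close>
  as a difference of two cone elements, and both parts vanish wherever \<open>P *v v\<close> does.
  The case of empty \<open>K\<close> gives full dimension, singletons give the facets.\<close>

lemma span_matrix_cone_face:
  fixes P :: "real^'n^'n"
  assumes P: "invertible P"
  shows "span {v \<in> matrix_cone P. \<forall>k\<in>K. (P *v v) $ k = 0} = {v. \<forall>k\<in>K. (P *v v) $ k = 0}"
    (is "span ?F = ?H")
proof
  have "subspace ?H"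
    by (auto simp: subspace_def matrix_vector_mult_scaleR matrix_vector_right_distrib)
  then show "span ?F \<subseteq> ?H" by (intro span_minimal) auto
  show "?H \<subseteq> span ?F"
  proof
    fix v assume v: "v \<in> ?H"
    let ?p = "matrix_inv P *v pos_part (P *v v)" and ?m = "matrix_inv P *v pos_part (- (P *v v))"
    have "?p \<in> ?F" "?m \<in> ?F"
      using v by (auto simp: matrix_cone_def mult_matrix_inv_vec[OF P] pos_part_def)
    then have "?p - ?m \<in> span ?F" by (intro span_diff span_base)
    moreover have "pos_part (P *v v) - pos_part (- (P *v v)) = P *v v"
      by (auto simp: vec_eq_iff pos_part_def)
    ultimately show "v \<in> span ?F"
      by (simp add: matrix_inv_mult_vec[OF P] flip: matrix_vector_mult_diff_distrib)
  qed
qed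

section \<open>Facets of simplicial cones and their normals\<close>

lemma aff_dim_matrix_cone:
  fixes P :: "real^'n^'n"
  assumes "invertible P"
  shows "aff_dim (matrix_cone P) = int CARD('n)"
proof -
  have "0 \<in> matrix_cone P" by (simp add: matrix_cone_def)
  then have "affine hull (matrix_cone P) = span (matrix_cone P)"
    by (intro affine_hull_span_0 hull_inc)
  also have "\<dots> = UNIV"
    using span_matrix_cone_face[OF assms, of "{}"] by simp
  finally have "aff_dim (affine hull (matrix_cone P)) = int CARD('n)" by simp
  then show ?thesis by simp
qed

lemma matrix_cone_facet:
  fixes P :: "real^'n^'n"
  assumes P: "invertible P"
  shows "{v \<in> matrix_cone P. row j P \<bullet> v = 0} facet_of matrix_cone P" (is "?F facet_of _")
proof -
  have "?F = matrix_cone P \<inter> {v. row j P \<bullet> v = 0}" by auto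
  also have "\<dots> face_of matrix_cone P"
    by (rule face_of_Int_supporting_hyperplane_ge)
      (rule convex_matrix_cone, simp add: matrix_cone_eq_INT)
  finally have "?F face_of matrix_cone P" .
  moreover have 0: "0 \<in> ?F" by (simp add: matrix_cone_def)
  moreover have "aff_dim ?F = aff_dim (matrix_cone P) - 1"
  proof -
    \<comment> \<open>Ensures that the equation of row \<open>j\<close> defines a genuine
      hyperplane, of dimension one less than the space.\<close>
    have "row j P \<noteq> 0"
    proof
      assume "row j P = 0"
      then have "(P *v (matrix_inv P *v axis j 1)) $ j = 0"
        unfolding matrix_vector_nth[of P] by simp
      then show False by (simp add: mult_matrix_inv_vec[OF P])
    qed
    have "affine hull ?F = span ?F"
      using 0 by (intro affine_hull_span_0 hull_inc)
    also have "\<dots> = {v. row j P \<bullet> v = 0}"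
      using span_matrix_cone_face[OF P, of "{j}"] by (simp add: matrix_vector_nth)
    finally have "aff_dim (affine hull ?F) = int CARD('n) - 1"
      using \<open>row j P \<noteq> 0\<close> by simp
    then show ?thesis by (simp add: aff_dim_matrix_cone[OF P])
  qed
  ultimately show ?thesis by (auto simp: facet_of_def)
qed

text \<open>For the hard inclusion, a facet normal \<open>s\<close> is tested on the edge vectors
  \<open>e k\<close>: exactly one \<open>s \<bullet> e j\<close> is nonzero, so \<open>s\<close> is
  a multiple of row \<open>j\<close>, and the unit norm together with the sign of
  \<open>s \<bullet> e j\<close> fixes the factor.\<close>

lemma facet_normals_matrix_cone:
  fixes P :: "real^'n^'n"
  assumes P: "invertible P"
  shows "facet_normals (matrix_cone P) = range (\<lambda>k. row k P /\<^sub>R norm (row k P))"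
proof (intro equalityI subsetI)
  \<comment> \<open>The columns of the inverse: the basis dual to the rows of \<open>P\<close>,
    spanning the extreme rays of the cone.\<close>
  define e where "e k = matrix_inv P *v axis k 1" for k
  have Pe: "row k P \<bullet> e j = (if k = j then 1 else 0)" for k j
    unfolding e_def by (simp add: mult_matrix_inv_vec[OF P] axis_def flip: matrix_vector_nth)
  have expand: "v = (\<Sum>k\<in>UNIV. (row k P \<bullet> v) *\<^sub>R e k)" for v
  proof -
    have "P *v v = P *v (\<Sum>k\<in>UNIV. (row k P \<bullet> v) *\<^sub>R e k)"
      by (simp add: vec_eq_iff matrix_vector_nth inner_sum_right Pe if_distrib cong: if_cong)
    then show ?thesis by (metis matrix_inv_mult_vec[OF P])
  qed
  have e_in: "e k \<in> matrix_cone P" for k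
    by (simp add: matrix_cone_eq_INT Pe)
  have row_nz: "row k P \<noteq> 0" for k
    using Pe[of k k] by auto
  fix s
  {
    assume "s \<in> range (\<lambda>k. row k P /\<^sub>R norm (row k P))"
    then obtain j where s: "s = row j P /\<^sub>R norm (row j P)" by blast
    have "{v \<in> matrix_cone P. s \<bullet> v = 0} = {v \<in> matrix_cone P. row j P \<bullet> v = 0}"
      using row_nz by (auto simp: s)
    then show "s \<in> facet_normals (matrix_cone P)"
      unfolding facet_normals_def using matrix_cone_facet[OF P, of j] row_nz
      by (auto simp: s matrix_cone_eq_INT)
  }
  assume s: "s \<in> facet_normals (matrix_cone P)"
  let ?F = "{y \<in> matrix_cone P. s \<bullet> y = 0}"
  have norm_s: "norm s = 1" and facet: "?F facet_of matrix_cone P"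
    and pos: "0 \<le> s \<bullet> e k" for k
    using s e_in by (auto simp: facet_normals_def)
  have s_inner: "s \<bullet> v = (\<Sum>k\<in>UNIV. (row k P \<bullet> v) * (s \<bullet> e k))" for v
    by (subst expand[of v]) (simp add: inner_sum_right)
  \<comment> \<open>If every \<open>s \<bullet> e k\<close> vanished, the expansion would give
    \<open>s \<bullet> s = 0\<close>, against the unit norm.\<close>
  obtain j where j: "s \<bullet> e j \<noteq> 0"
    using s_inner[of s] norm_s by (force simp: dot_square_norm)
  have dimF: "aff_dim ?F = int CARD('n) - 1"
    using facet by (simp add: facet_of_def aff_dim_matrix_cone[OF P])
  have "?F \<noteq> {}" using facet by (simp add: facet_of_def)
  \<comment> \<open>On the facet a sum of nonnegative terms is zero, so every term is zero; the
    \<open>j\<close>-th one has the nonzero factor \<open>s \<bullet> e j\<close>.\<close>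
  have "row j P \<bullet> y = 0" if "y \<in> ?F" for y
  proof -
    have "(\<Sum>k\<in>UNIV. (row k P \<bullet> y) * (s \<bullet> e k)) = 0"
      using s_inner[of y] that by simp
    then have "\<forall>k\<in>UNIV. (row k P \<bullet> y) * (s \<bullet> e k) = 0"
      by (subst (asm) sum_nonneg_eq_0_iff) (use that pos in \<open>auto simp: matrix_cone_eq_INT\<close>)
    then show ?thesis using j by auto
  qed
  then have sub: "?F \<subseteq> {y. row j P \<bullet> y = 0}" "?F \<subseteq> {y. s \<bullet> y = 0}" by auto
  \<comment> \<open>The facet has the dimension of a hyperplane, so its affine hull fills any such
    hyperplane that contains it. Hence the hyperplanes of row \<open>j\<close> and of
    \<open>s\<close> coincide.\<close>
  have hyper: "affine hull ?F = {y. a \<bullet> y = 0}" if "?F \<subseteq> {y. a \<bullet> y = 0}" "a \<noteq> 0" for a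
    by (rule affine_dim_equal)
      (use that dimF \<open>?F \<noteq> {}\<close> in
        \<open>simp_all add: affine_hyperplane hull_minimal\<close>)
  have "{y. row j P \<bullet> y = 0} = {y. s \<bullet> y = 0}"
    using hyper[OF sub(1)] hyper[OF sub(2)] row_nz norm_s by force
  \<comment> \<open>For \<open>k \<noteq> j\<close> duality puts \<open>e k\<close> in the
    hyperplane of row \<open>j\<close>, hence in that of \<open>s\<close>.\<close>
  then have "s \<bullet> e k = 0" if "k \<noteq> j" for k
    using that Pe[of j k] by auto
  then have summand: "(row k P \<bullet> v) * (s \<bullet> e k)
      = (if k = j then (row j P \<bullet> v) * (s \<bullet> e j) else 0)" for k v
    by auto
  have "s \<bullet> v = ((s \<bullet> e j) *\<^sub>R row j P) \<bullet> v" for v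
  proof -
    have "s \<bullet> v = (\<Sum>k\<in>UNIV. if k = j then (row j P \<bullet> v) * (s \<bullet> e j) else 0)"
      by (subst s_inner) (rule sum.cong[OF refl summand])
    then show ?thesis by simp
  qed
  then have s_eq: "s = (s \<bullet> e j) *\<^sub>R row j P"
    by (subst vector_eq_rdot[symmetric]) blast
  then have "1 = (s \<bullet> e j) * norm (row j P)"
    using norm_s pos[of j] by (metis abs_of_nonneg norm_scaleR)
  then have "s \<bullet> e j = inverse (norm (row j P))"
    using row_nz[of j] by (simp add: field_simps)
  then show "s \<in> range (\<lambda>k. row k P /\<^sub>R norm (row k P))"
    using s_eq by (intro image_eqI[of _ _ j]) auto
qed

text \<open>The rows of \<open>S\<close> are the normalized rows of \<open>P\<close> in some order.
  Positive scaling and reordering change neither the cone nor invertibility.\<close>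

lemma facet_normal_matrix_cone:
  fixes P :: "real^'n^'n" and S :: "real^'n^'l"
  assumes P: "invertible P" and S: "facet_normal_matrix S (matrix_cone P)"
  shows "invertible S" and "matrix_cone S = matrix_cone P"
proof -
  have range: "range (\<lambda>l. row l S) = range (\<lambda>k. row k P /\<^sub>R norm (row k P))"
    and inj: "inj (\<lambda>l. row l S)"
    using S by (auto simp: facet_normal_matrix_def bij_betw_def facet_normals_matrix_cone[OF P])
  have row_nz: "row k P \<noteq> 0" for k
  proof
    assume "row k P = 0"
    then have "(P *v (matrix_inv P *v axis k 1)) $ k = 0"
      unfolding matrix_vector_nth[of P] by simp
    then show False by (simp add: mult_matrix_inv_vec[OF P])
  qed
  obtain \<sigma> where \<sigma>: "row l S = row (\<sigma> l) P /\<^sub>R norm (row (\<sigma> l) P)" for l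
  proof -
    have "\<forall>l. \<exists>k. row l S = row k P /\<^sub>R norm (row k P)"
      using range by blast
    then show ?thesis using that by (auto dest: choice)
  qed
  have inj_\<sigma>: "inj \<sigma>"
  proof (rule injI)
    fix l l' assume "\<sigma> l = \<sigma> l'"
    then have "row l S = row l' S" by (simp add: \<sigma>)
    with inj show "l = l'" by (rule injD)
  qed
  have dir: "\<exists>l t. 0 < t \<and> row k P = t *\<^sub>R row l S" for k
  proof -
    obtain l where l: "row k P /\<^sub>R norm (row k P) = row l S"
      using range by blast
    have "row k P = norm (row k P) *\<^sub>R row l S"
      using row_nz[of k] unfolding l[symmetric] by simp
    then show ?thesis using row_nz[of k] by (metis zero_less_norm_iff)
  qed
  show "matrix_cone S = matrix_cone P"
  proof (intro equalityI subsetI)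
    fix v assume "v \<in> matrix_cone S"
    then have "0 \<le> row k P \<bullet> v" for k
      using dir[of k] by (auto simp: matrix_cone_eq_INT)
    then show "v \<in> matrix_cone P" by (simp add: matrix_cone_eq_INT)
  qed (simp add: matrix_cone_eq_INT \<sigma>)
  \<comment> \<open>The row index types are not identified, so a left and a right inverse are built
    separately and then shown to be equal.\<close>
  have "inj ((*v) S)"
  proof (rule injI)
    fix x y assume "S *v x = S *v y"
    then have "row l S \<bullet> x = row l S \<bullet> y" for l by (metis matrix_vector_nth)
    then have "row k P \<bullet> x = row k P \<bullet> y" for k using dir[of k] by auto
    then have "P *v x = P *v y" by (simp add: vec_eq_iff matrix_vector_nth)
    then show "x = y" by (metis matrix_inv_mult_vec[OF P])
  qed
  then obtain B where B: "B ** S = mat 1"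
    using matrix_left_invertible_injective by blast
  have "surj ((*v) S)"
  proof (rule surjI)
    fix u :: "real^'l"
    \<comment> \<open>Prescribes the coordinates \<open>P *v v\<close> of the desired preimage:
      \<open>inv \<sigma>\<close> undoes the reordering and the factor undoes the
      normalization.\<close>
    define x :: "real^'n" where "x = (\<chi> k. norm (row k P) * u $ inv \<sigma> k)"
    have "(S *v (matrix_inv P *v x)) $ l = u $ l" for l
    proof -
      have "(S *v (matrix_inv P *v x)) $ l = x $ \<sigma> l / norm (row (\<sigma> l) P)"
        unfolding matrix_vector_nth[of S] \<sigma> inner_scaleR_left
        by (simp add: mult_matrix_inv_vec[OF P] divide_inverse mult.commute
            flip: matrix_vector_nth[of P])
      then show ?thesis using row_nz[of "\<sigma> l"] by (simp add: x_def inj_\<sigma>)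
    qed
    then show "S *v (matrix_inv P *v x) = u" by (simp add: vec_eq_iff)
  qed
  then obtain B' where B': "S ** B' = mat 1"
    using matrix_right_invertible_surjective by metis
  have "B = B ** (S ** B')" by (simp add: B')
  also have "\<dots> = B'" by (simp add: matrix_mul_assoc B)
  finally show "invertible S" using B B' by (auto simp: invertible_def)
qed

section \<open>The normal cone at a nondegenerate vertex\<close>

lemma feasible_direction:
  fixes A :: "real^'n^'m"
  assumes z: "z \<in> ineq_polyhedron A b"
    and d: "\<And>i. i \<in> active_set A b z \<Longrightarrow> row i A \<bullet> d \<le> 0"
  shows "\<forall>\<^sub>F t in at_right 0. z + t *\<^sub>R d \<in> ineq_polyhedron A b"
proof -
  \<comment> \<open>Active constraints do not increase along \<open>d\<close>; inactive ones have
    slack, which continuity preserves for small \<open>t\<close>. Finitely many such conditions hold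
    simultaneously.\<close>
  have "\<forall>\<^sub>F t in at_right 0. row i A \<bullet> (z + t *\<^sub>R d) \<le> b $ i" for i
  proof (cases "i \<in> active_set A b z")
    case True
    have "row i A \<bullet> (z + t *\<^sub>R d) \<le> b $ i" if "0 < t" for t
      using True d[OF True] that
      by (simp add: active_set_def inner_add_right mult_nonneg_nonpos)
    then show ?thesis by (rule eventually_mono[OF eventually_at_right_less])
  next
    case False
    have "((\<lambda>t. row i A \<bullet> (z + t *\<^sub>R d)) \<longlongrightarrow> row i A \<bullet> (z + 0 *\<^sub>R d)) (at_right 0)"
      by (intro tendsto_intros)
    moreover have "row i A \<bullet> (z + 0 *\<^sub>R d) < b $ i"
      using False z by (simp add: active_set_def ineq_polyhedron_def less_le)
    ultimately have "\<forall>\<^sub>F t in at_right 0. row i A \<bullet> (z + t *\<^sub>R d) < b $ i"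
      by (rule order_tendstoD)
    then show ?thesis by (auto elim: eventually_mono)
  qed
  then show ?thesis
    by (simp add: ineq_polyhedron_def eventually_all_finite)
qed

text \<open>The active rows form an invertible matrix \<open>M\<close>, and the normal cone consists
  of their nonnegative combinations; \<open>P *v v\<close> is the vector of coefficients of
  \<open>v\<close> in terms of these rows.\<close>

lemma normal_cone_nondegenerate_vertex:
  fixes A :: "real^'n^'m"
  assumes vertex: "z extreme_point_of ineq_polyhedron A b"
    and nondeg: "nondegenerate_at A b z"
  obtains P :: "real^'n^'n"
  where "invertible P" "normal_cone (ineq_polyhedron A b) z = matrix_cone P"
proof -
  let ?Q = "ineq_polyhedron A b" and ?J = "active_set A b z"
  have z: "z \<in> ?Q" using vertex by (simp add: extreme_point_of_def)
  obtain \<beta> where \<beta>: "bij_betw \<beta> (UNIV :: 'n set) ?J"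
    using nondeg finite_same_card_bij[of "UNIV :: 'n set" ?J]
    by (auto simp: nondegenerate_at_def)
  define M :: "real^'n^'n" where "M = (\<chi> k. row (\<beta> k) A)"
  have M_nth: "(M *v x) $ k = row (\<beta> k) A \<bullet> x" for x k
    unfolding matrix_vector_nth by (simp add: M_def row_def)
  have active: "i \<in> ?J \<Longrightarrow> \<exists>k. i = \<beta> k" "\<beta> k \<in> ?J" for i k
    using \<beta> by (auto simp: bij_betw_def)
  \<comment> \<open>A nonzero kernel vector would leave all active constraints tight, so
    \<open>z\<close> could move both ways inside the polyhedron and would be the midpoint of a
    segment in it.\<close>
  have "d = 0" if Md: "M *v d = 0" for d
  proof (rule ccontr)
    assume "d \<noteq> 0"
    have "row i A \<bullet> d = 0" if "i \<in> ?J" for i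
      using active(1)[OF that] M_nth[of d] Md by auto
    then have "\<forall>\<^sub>F t in at_right 0. z + t *\<^sub>R d \<in> ?Q" "\<forall>\<^sub>F t in at_right 0. z + t *\<^sub>R (- d) \<in> ?Q"
      by (intro feasible_direction[OF z]; simp)+
    then have "\<forall>\<^sub>F t in at_right 0. z + t *\<^sub>R d \<in> ?Q \<and> z + t *\<^sub>R (- d) \<in> ?Q \<and> 0 < t"
      by (intro eventually_conj eventually_at_right_less)
    then obtain t where t: "z + t *\<^sub>R d \<in> ?Q" "z + t *\<^sub>R (- d) \<in> ?Q" "0 < t"
      using eventually_happens'[OF trivial_limit_at_right_real] by blast
    have "z = midpoint (z + t *\<^sub>R d) (z + t *\<^sub>R (- d))"
      by (simp add: midpoint_def scaleR_add_right flip: scaleR_add_left)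
    moreover have "z + t *\<^sub>R d \<noteq> z + t *\<^sub>R (- d)"
      using t \<open>d \<noteq> 0\<close> by (auto simp: eq_neg_iff_add_eq_0 simp flip: scaleR_2)
    ultimately have "z \<in> open_segment (z + t *\<^sub>R d) (z + t *\<^sub>R (- d))"
      by (metis midpoint_in_open_segment)
    then show False using vertex t by (auto simp: extreme_point_of_def)
  qed
  then have "invertible M"
    by (simp add: invertible_left_inverse matrix_left_invertible_ker)
  \<comment> \<open>The inverse transpose turns \<open>v \<bullet> u\<close> into
    \<open>(P *v v) \<bullet> (M *v u)\<close>, pairing normals in \<open>P\<close>-coordinates with
    displacements in \<open>M\<close>-coordinates.\<close>
  define P where "P = transpose (matrix_inv M)"
  have inner: "v \<bullet> u = (P *v v) \<bullet> (M *v u)" for u v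
  proof -
    have "(P *v v) \<bullet> (M *v u) = v \<bullet> (matrix_inv M *v (M *v u))"
      by (simp add: P_def dot_lmul_matrix)
    then show ?thesis by (simp add: matrix_inv_mult_vec[OF \<open>invertible M\<close>])
  qed
  have "invertible P"
    unfolding P_def using matrix_inv_mult[OF \<open>invertible M\<close>]
    by (intro transpose_invertible) (auto simp: invertible_def)
  moreover have "normal_cone ?Q z = matrix_cone P"
  proof (intro equalityI subsetI)
    fix v assume v: "v \<in> normal_cone ?Q z"
    have "0 \<le> (P *v v) $ k" for k
    proof -
      \<comment> \<open>The edge direction from \<open>z\<close> along which the \<open>k\<close>-th
        active constraint is relaxed and the other active ones stay tight; testing \<open>v\<close>
        on it isolates the \<open>k\<close>-th coordinate.\<close>
      define d where "d = matrix_inv M *v (- axis k 1)"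
      have Md: "M *v d = - axis k 1"
        by (simp add: d_def mult_matrix_inv_vec[OF \<open>invertible M\<close>])
      have "row i A \<bullet> d \<le> 0" if "i \<in> ?J" for i
        using active(1)[OF that] by (auto simp: Md axis_def simp flip: M_nth)
      then have "\<forall>\<^sub>F t in at_right 0. z + t *\<^sub>R d \<in> ?Q \<and> 0 < t"
        by (intro eventually_conj eventually_at_right_less feasible_direction[OF z])
      then obtain t where t: "z + t *\<^sub>R d \<in> ?Q" "0 < t"
        using eventually_happens'[OF trivial_limit_at_right_real] by blast
      then have "v \<bullet> ((z + t *\<^sub>R d) - z) \<le> 0"
        using v unfolding normal_cone_def by blast
      then have "v \<bullet> d \<le> 0" using t(2) by (simp add: mult_le_0_iff)
      then have "(P *v v) \<bullet> - axis k 1 \<le> 0" by (simp only: inner[of v d] Md)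
      then show ?thesis by (simp add: inner_axis)
    qed
    then show "v \<in> matrix_cone P" by (simp add: matrix_cone_def)
  next
    fix v assume v: "v \<in> matrix_cone P"
    have "v \<bullet> (y - z) \<le> 0" if y: "y \<in> ?Q" for y
    proof -
      \<comment> \<open>Active rows attain their bounds at \<open>z\<close>, so feasibility of
        \<open>y\<close> gives the sign. Multiplied with the nonnegative coordinates of
        \<open>P *v v\<close>, every term of the inner product is nonpositive.\<close>
      have "(M *v (y - z)) $ k \<le> 0" for k
        using y active(2)[of k] by (simp add: M_nth inner_diff_right active_set_def ineq_polyhedron_def)
      then show ?thesis
        unfolding inner[of v] inner_vec_def[of "P *v v"]
        using v by (simp add: matrix_cone_def sum_nonpos mult_nonneg_nonpos)
    qed
    then show "v \<in> normal_cone ?Q z" by (simp add: normal_cone_def)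
  qed
  ultimately show ?thesis by (rule that)
qed

section \<open>Projection onto the dual cone and conclusion\<close>

lemma closed_dual_cone: "closed (dual_cone T)"
proof -
  have "dual_cone T = (\<Inter>x\<in>T. {y. 0 \<le> y \<bullet> x})"
    by (auto simp: dual_cone_def)
  then show ?thesis
    by (simp add: closed_INT closed_Collect_le continuous_intros)
qed

lemma convex_dual_cone: "convex (dual_cone T)"
  by (auto simp: convex_def dual_cone_def inner_add_left)

lemma cone_dual_cone: "cone (dual_cone T)"
  by (auto simp: cone_def dual_cone_def)

text \<open>The variational inequality for the projection, tested at 0 and at twice the projection,
  gives both signs of the inner product.\<close>

lemma closest_point_cone_orthogonal:
  fixes D :: "'a::euclidean_space set"
  assumes "closed D" "convex D" "cone D" "D \<noteq> {}"
  shows "closest_point D u \<bullet> (u - closest_point D u) = 0"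
proof -
  let ?p = "closest_point D u"
  have p: "?p \<in> D" using assms by (intro closest_point_in_set)
  have le: "(u - ?p) \<bullet> (c *\<^sub>R ?p - ?p) \<le> 0" if "0 \<le> c" for c
    using assms(1-3) p that by (intro closest_point_dot mem_cone)
  show ?thesis
    using le[of 0] le[of 2] by (simp add: scaleR_2 inner_commute)
qed

lemma infdist_eq_norm_closest_point:
  fixes D :: "'a::euclidean_space set"
  assumes "closed D" "D \<noteq> {}"
  shows "infdist u D = norm (u - closest_point D u)"
  using setdist_closest_point[OF assms, of u] infdist_eq_setdist[of u D] by (simp add: dist_norm)

theorem theorem2p5:
  fixes A :: "real^'n^'m" and b :: "real^'m"
    and Q T :: "(real^'n) set"
    and \<psi> :: "real^'n \<Rightarrow> ereal"
    and z :: "real^'n" and \<epsilon> :: real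
    and S :: "real^'n^'l"
  assumes Q: "Q = ineq_polyhedron A b" and Q_nonempty: "Q \<noteq> {}"
    and psi_proper: "proper_fun \<psi>" and psi_convex: "convex_fun \<psi>"
    and vertex: "z extreme_point_of Q"
    and eps: "0 \<le> \<epsilon>"
    and T: "T = normal_cone Q z"
    and nondeg: "nondegenerate_at A b z"
    and S: "facet_normal_matrix S T"
  shows "invertible S
    \<and> (\<forall>w \<in> subdifferential (scaled_fun \<epsilon> \<psi>) z.
         measure std_gaussian (T \<inter> (T + subdifferential (scaled_fun \<epsilon> \<psi>) z))
           \<ge> measure std_gaussian T
              * exp (- (1/2) * (norm (tilde S w))\<^sup>2 - norm (tilde S w) * sqrt (real CARD('n))))
    \<and> (\<forall>g. has_gradient \<psi> z g \<longrightarrow>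
         measure std_gaussian (T \<inter> (T + {\<epsilon> *\<^sub>R g}))
           \<le> measure std_gaussian T
              * exp (- (1/2) * (norm (closest_point (dual_cone T) (tilde S (\<epsilon> *\<^sub>R g))))\<^sup>2
                     + infdist (tilde S (\<epsilon> *\<^sub>R g)) (dual_cone T) * sqrt (real CARD('n))))"
proof -
  obtain P :: "real^'n^'n" where P: "invertible P" "T = matrix_cone P"
    using normal_cone_nondegenerate_vertex vertex nondeg unfolding Q T by blast
  have inv: "invertible S" and T_eq: "T = matrix_cone S"
    using facet_normal_matrix_cone[OF P(1)] S P(2) by auto
  have cone: "cone T" and closed: "closed T"
    by (simp_all add: T_eq cone_matrix_cone closed_matrix_cone)
  have borel: "T \<in> sets borel" using closed by (rule borel_closed)
  have translate: "T \<inter> (T + {w}) = (\<lambda>x. x + tilde S w) ` T" for w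
    unfolding T_eq by (rule matrix_cone_Int_translate[OF inv])
  show ?thesis
  proof (intro conjI ballI allI impI)
    fix w
    let ?D = "subdifferential (scaled_fun \<epsilon> \<psi>) z"
    assume w: "w \<in> ?D"
    \<comment> \<open>Monotonicity of the measure requires the larger set to be measurable, since
      otherwise its \<open>measure\<close> would be 0 by default.\<close>
    have "T \<inter> (T + ?D) \<in> sets borel"
      using borel set_plus_closed_borel[OF closed closed_subdifferential] by simp
    moreover have "T \<inter> (T + {w}) \<subseteq> T \<inter> (T + ?D)"
      using w by (intro Int_mono set_plus_mono2) auto
    ultimately have "measure std_gaussian (T \<inter> (T + {w})) \<le> measure std_gaussian (T \<inter> (T + ?D))"
      unfolding measure_def using emeasure_std_gaussian_finite
      by (intro enn2real_mono emeasure_mono) (simp_all add: std_gaussian_def)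
    then show "measure std_gaussian (T \<inter> (T + ?D))
        \<ge> measure std_gaussian T
            * exp (- (1/2) * (norm (tilde S w))\<^sup>2 - norm (tilde S w) * sqrt (real CARD('n)))"
      unfolding translate using gaussian_cone_translate_ge[OF borel cone] order_trans by blast
  next
    fix g
    let ?u = "tilde S (\<epsilon> *\<^sub>R g)"
    \<comment> \<open>\<open>?p\<close> and \<open>?u - ?p\<close> are the orthogonal components
      required by \<open>gaussian_cone_translate_le\<close>; the norm of the second is the distance
      to the dual cone.\<close>
    let ?p = "closest_point (dual_cone T) ?u"
    have ne: "dual_cone T \<noteq> {}"
      by (auto simp: dual_cone_def intro: exI[of _ 0])
    show "measure std_gaussian (T \<inter> (T + {\<epsilon> *\<^sub>R g}))
        \<le> measure std_gaussian T
            * exp (- (1/2) * (norm ?p)\<^sup>2 + infdist ?u (dual_cone T) * sqrt (real CARD('n)))"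
      unfolding translate infdist_eq_norm_closest_point[OF closed_dual_cone ne]
    proof (rule gaussian_cone_translate_le[OF borel cone])
      show "?p \<in> dual_cone T"
        by (rule closest_point_in_set[OF closed_dual_cone ne])
      show "?p \<bullet> (?u - ?p) = 0"
        by (rule closest_point_cone_orthogonal[OF closed_dual_cone convex_dual_cone cone_dual_cone ne])
    qed simp
  qed (rule inv)
qed

end
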